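(* Let $k \ge 1$ and let $S = \{F_2, F_3, \ldots, F_{k+1}\}$ be the set of numbers of cookies in $k$ jars, where $F_i$ denotes the Fibonacci numbers. Then $\mathrm{CM}(S) = \left\lceil \frac{k+1}{2} \right\rceil$.
   Context: The Fibonacci sequence is defined by $F_0 = 0$, $F_1 = 1$, and $F_i = F_{i-2} + F_{i-1}$ for $i \ge 2$. A set $S = \{j_1 < j_2 < \cdots < j_k\}$ of distinct positive integers represents $k$ jars, where the $i$-th jar initially contains $j_i$ cookies. A move consists of choosing any subset of the jars and a positive integer $a$, such that every chosen jar currently contains at least $a$ cookies, and removing exactly $a$ cookies from each chosen jar (the same number from each). The Cookie Monster number $\mathrm{CM}(S)$ is the minimum number of moves needed to empty all of the jars. *)

theory Defs
  imports Complex_Main "HOL-Number_Theory.Fib"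
begin

text \<open>
  The initial cookie counts are pairwise distinct, so each jar is named by the number of
  cookies it starts with: \<open>S :: nat set\<close> is the set of jars, and a state
  \<open>c :: nat \<Rightarrow> nat\<close> gives the current contents of every jar. The initial state is
  therefore \<open>\<lambda>j. j\<close>; values of a state outside \<open>S\<close> are irrelevant.
\<close>

definition cookie_move :: "nat set \<Rightarrow> (nat \<Rightarrow> nat) \<Rightarrow> (nat \<Rightarrow> nat) \<Rightarrow> bool" where
  "cookie_move S c c' \<longleftrightarrow>
     (\<exists>A a. A \<subseteq> S \<and> 0 < a \<and> (\<forall>j\<in>A. a \<le> c j) \<and>
            c' = (\<lambda>j. if j \<in> A then c j - a else c j))"

definition emptied_in :: "nat set \<Rightarrow> nat \<Rightarrow> bool" where
  "emptied_in S n \<longleftrightarrow> (\<exists>c. (cookie_move S ^^ n) (\<lambda>j. j) c \<and> (\<forall>j\<in>S. c j = 0))"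

definition CM :: "nat set \<Rightarrow> nat" where
  "CM S = (LEAST n. emptied_in S n)"

text \<open>The minimum in \<open>CM\<close> is attained whenever there are finitely many jars.\<close>

lemma emptied_in_exists:
  assumes "finite S"
  shows "\<exists>n. emptied_in S n"
proof -
  have "\<exists>n c. (cookie_move S ^^ n) (\<lambda>j. j) c \<and> (\<forall>j\<in>T. c j = 0)"
    if "finite T" "T \<subseteq> S" for T
    using that
  proof (induction T rule: finite_induct)
    case empty
    have "(cookie_move S ^^ 0) (\<lambda>j. j) (\<lambda>j. j)" by simp
    then show ?case by blast
  next
    case (insert x T)
    then obtain n c where c: "(cookie_move S ^^ n) (\<lambda>j. j) c" "\<forall>j\<in>T. c j = 0" by auto
    show ?case
    proof (cases "c x = 0")
      case True
      with c show ?thesis by auto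
    next
      case False
      define d where "d = (\<lambda>j. if j \<in> {x} then c j - c x else c j)"
      have "cookie_move S c d"
        unfolding cookie_move_def d_def using False insert.prems
        by (intro exI[of _ "{x}"] exI[of _ "c x"]) auto
      with c(1) have "(cookie_move S ^^ Suc n) (\<lambda>j. j) d" by auto
      moreover have "\<forall>j\<in>insert x T. d j = 0" using c(2) by (simp add: d_def)
      ultimately show ?thesis by blast
    qed
  qed
  from this[OF assms subset_refl] show ?thesis by (auto simp: emptied_in_def)
qed

end

theory Submission imports Defs begin

text \<open>
  The order of the moves is irrelevant: \<open>n\<close> moves empty the jars exactly when there are \<open>n\<close>
  positive amounts such that every \<open>j \<in> S\<close> is the sum of the amounts taken by the moves that
  touch jar \<open>j\<close> (lemmas \<open>emptied_in_imp_splits\<close> and \<open>splits_imp_emptied_in\<close>). The claim is thus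
  about writing Fibonacci numbers as subset sums of few numbers.

  Enough moves: the amounts \<open>F\<^sub>1, F\<^sub>3, \<dots>, F\<^bsub>2n-1\<^esub>\<close> yield every \<open>F\<^sub>2, \<dots>, F\<^bsub>2n\<^esub>\<close>, because an
  odd-indexed Fibonacci number is itself an amount, and \<open>F\<^bsub>2m\<^esub> = F\<^sub>1 + F\<^sub>3 + \<dots> + F\<^bsub>2m-1\<^esub>\<close>.

  No fewer moves: the moves that touch a jar of some set \<open>T\<close> take at most \<open>\<Sum>T\<close> cookies from any
  one jar. A jar with more than \<open>\<Sum>T\<close> cookies therefore needs a move that touches no jar of \<open>T\<close>,
  and dropping this move still empties \<open>T\<close> (lemma \<open>splits_drop_move\<close>). Since
  \<open>F\<^sub>2 + \<dots> + F\<^bsub>k-1\<^esub> < F\<^bsub>k+1\<^esub>\<close>, the jars \<open>F\<^sub>2, \<dots>, F\<^bsub>k+1\<^esub>\<close> need at least one move more than the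
  jars \<open>F\<^sub>2, \<dots>, F\<^bsub>k-1\<^esub>\<close>, so by induction \<open>n\<close> moves suffice for at most \<open>2n - 1\<close> jars,
  the induction starting from one jar, which needs one move, and from \<open>{1, 2}\<close>, which needs two.
\<close>

text \<open>
  A schedule of moves without its order: move \<open>i\<close> takes \<open>a i\<close> cookies from each jar in \<open>A i\<close>.
  Moves are indexed by a set rather than by an initial segment of the naturals so that a single
  move can be dropped without renumbering the others.
\<close>

definition splits :: "nat set \<Rightarrow> 'i set \<Rightarrow> ('i \<Rightarrow> nat) \<Rightarrow> ('i \<Rightarrow> nat set) \<Rightarrow> bool" where
  "splits S I a A \<longleftrightarrow> (\<forall>j\<in>S. j = (\<Sum>i\<in>I. if j \<in> A i then a i else 0))"

lemma moves_imp_sum: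
  assumes "(cookie_move S ^^ n) c d"
  shows "\<exists>a A. \<forall>j. c j = d j + (\<Sum>i<n. if j \<in> A i then a i else (0::nat))"
  using assms
proof (induction n arbitrary: d)
  case 0
  then show ?case by simp
next
  case (Suc n)
  then obtain e where e: "(cookie_move S ^^ n) c e" "cookie_move S e d"
    by auto
  from Suc.IH[OF e(1)] obtain a A
    where aA: "\<And>j. c j = e j + (\<Sum>i<n. if j \<in> A i then a i else 0)" by blast
  from e(2) obtain B b where B: "\<forall>j\<in>B. b \<le> e j" "d = (\<lambda>j. if j \<in> B then e j - b else e j)"
    unfolding cookie_move_def by blast
  have "c j = d j + (\<Sum>i<Suc n. if j \<in> (A(n := B)) i then (a(n := b)) i else 0)" for j
  proof -
    have "(\<Sum>i<n. if j \<in> (A(n := B)) i then (a(n := b)) i else 0)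
        = (\<Sum>i<n. if j \<in> A i then a i else 0)"
      by (rule sum.cong) auto
    moreover have "e j = d j + (if j \<in> B then b else 0)"
      using B by auto
    ultimately show ?thesis using aA[of j] by simp
  qed
  then show ?case by blast
qed

lemma emptied_in_imp_splits:
  assumes "emptied_in S n"
  shows "\<exists>a A. splits S {..<n} a A"
proof -
  obtain c where c: "(cookie_move S ^^ n) (\<lambda>j. j) c" "\<forall>j\<in>S. c j = 0"
    using assms unfolding emptied_in_def by blast
  obtain a A where "\<And>j. j = c j + (\<Sum>i<n. if j \<in> A i then a i else (0::nat))"
    using moves_imp_sum[OF c(1)] by blast
  with c(2) have "splits S {..<n} a A"
    unfolding splits_def by (metis add_0)
  then show ?thesis by blast
qed

text \<open>
  The moves can be carried out in the order of their indices: a partial sum never exceeds the full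
  sum \<open>j\<close>, so jar \<open>j\<close> always holds enough cookies for the next move.
\<close>

lemma splits_imp_emptied_in:
  assumes split: "splits S {..<n} a A"
    and A: "\<And>i. i < n \<Longrightarrow> A i \<subseteq> S" and a: "\<And>i. i < n \<Longrightarrow> 0 < a i"
  shows "emptied_in S n"
proof -
  define taken where "taken m j = (\<Sum>i<m. if j \<in> A i then a i else 0)" for m j
  have "(cookie_move S ^^ m) (\<lambda>j. j) (\<lambda>j. j - taken m j)" if "m \<le> n" for m
    using that
  proof (induction m)
    case 0
    then show ?case by (simp add: taken_def)
  next
    case (Suc m)
    have "a m \<le> j - taken m j" if "j \<in> A m" for j
    proof -
      have "taken (Suc m) j \<le> taken n j"
        unfolding taken_def using Suc.prems by (intro sum_mono2) auto
      moreover have "taken n j = j"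
        using split A[of m] that Suc.prems unfolding splits_def taken_def by auto
      ultimately show ?thesis using that by (simp add: taken_def)
    qed
    then have "cookie_move S (\<lambda>j. j - taken m j) (\<lambda>j. j - taken (Suc m) j)"
      unfolding cookie_move_def using A[of m] a[of m] Suc.prems
      by (intro exI[of _ "A m"] exI[of _ "a m"]) (auto simp: taken_def)
    with Suc show ?case by auto
  qed
  moreover have "\<forall>j\<in>S. j - taken n j = 0"
    using split unfolding splits_def taken_def by simp
  ultimately show ?thesis unfolding emptied_in_def by blast
qed

text \<open>
  If every move touched a jar of \<open>T\<close>, its amount could be charged to such a jar. Each jar \<open>t \<in> T\<close>
  is charged at most \<open>t\<close> in all, so all amounts together would not reach \<open>s\<close>.
\<close>

lemma splits_drop_move:
  assumes "finite I" "finite T" and split: "splits (insert s T) I a A" and large: "\<Sum>T < s"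
  shows "\<exists>i\<in>I. splits T (I - {i}) a A"
proof -
  have "\<exists>i\<in>I. \<forall>t\<in>T. t \<notin> A i"
  proof (rule ccontr)
    assume "\<not> ?thesis"
    then have touch: "\<exists>t\<in>T. t \<in> A i" if "i \<in> I" for i using that by blast
    have "s = (\<Sum>i\<in>I. if s \<in> A i then a i else 0)"
      using split unfolding splits_def by blast
    also have "\<dots> \<le> (\<Sum>i\<in>I. \<Sum>t\<in>T. if t \<in> A i then a i else 0)"
    proof (rule sum_mono)
      fix i assume "i \<in> I"
      then obtain t where t: "t \<in> T" "t \<in> A i" using touch by blast
      have "(if s \<in> A i then a i else 0) \<le> (if t \<in> A i then a i else 0)"
        using t by simp
      also have "\<dots> \<le> (\<Sum>t\<in>T. if t \<in> A i then a i else 0)"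
        using \<open>finite T\<close> t by (intro member_le_sum) auto
      finally show "(if s \<in> A i then a i else 0) \<le> (\<Sum>t\<in>T. if t \<in> A i then a i else 0)" .
    qed
    also have "\<dots> = (\<Sum>t\<in>T. \<Sum>i\<in>I. if t \<in> A i then a i else 0)"
      by (rule sum.swap)
    also have "\<dots> = \<Sum>T"
      using split unfolding splits_def by (intro sum.cong) auto
    finally show False using large by simp
  qed
  then obtain i where i: "i \<in> I" "\<forall>t\<in>T. t \<notin> A i" by blast
  have "splits T (I - {i}) a A"
    unfolding splits_def
  proof
    fix t assume "t \<in> T"
    then have "t = (\<Sum>i\<in>I. if t \<in> A i then a i else 0)"
      using split unfolding splits_def by blast
    also have "\<dots> = (\<Sum>i\<in>I - {i}. if t \<in> A i then a i else 0)"
      using i \<open>t \<in> T\<close> \<open>finite I\<close> by (simp add: sum.remove)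
    finally show "t = (\<Sum>i\<in>I - {i}. if t \<in> A i then a i else 0)" .
  qed
  with i show ?thesis by blast
qed

lemma sum_fib_from_2_less: "(\<Sum>j=2..m. fib j) < fib (m + 2)"
proof (induction m)
  case 0
  then show ?case by simp
next
  case (Suc m)
  then show ?case by (cases "m = 0") (auto simp: numeral_2_eq_2)
qed

lemma splits_fib_lower_bound:
  assumes "finite I" "k \<ge> 1" "splits (fib ` {2..k + 1}) I a A"
  shows "k < 2 * card I"
  using assms
proof (induction k arbitrary: I rule: less_induct)
  case (less k)
  (* The second largest jar is discarded together with the largest, since with it the remaining
     jars would hold too many cookies in total. For k = 2 this would leave no jar and only prove
     that one move is needed; there F_2 < F_3 allows the jar F_2 to stay. *)
  define m where "m = (if k = 2 then 2 else k - 1)"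
  have "\<Sum>(fib ` {2..m}) \<le> (\<Sum>j=2..m. fib j)"
    using sum_image_le[of "{2..m}" "\<lambda>x. x" fib] by simp
  also have "\<dots> < fib (k + 1)"
    using sum_fib_from_2_less[of "k - 1"] less.prems(2)
    by (auto simp: m_def numeral_eq_Suc)
  finally have large: "\<Sum>(fib ` {2..m}) < fib (k + 1)" .
  have "fib ` insert (k + 1) {2..m} \<subseteq> fib ` {2..k + 1}"
    using less.prems(2) by (intro image_mono) (auto simp: m_def)
  then have "insert (fib (k + 1)) (fib ` {2..m}) \<subseteq> fib ` {2..k + 1}"
    by simp
  with less.prems(3) have "splits (insert (fib (k + 1)) (fib ` {2..m})) I a A"
    unfolding splits_def by blast
  with splits_drop_move[OF \<open>finite I\<close> _ _ large]
  obtain i where i: "i \<in> I" "splits (fib ` {2..m}) (I - {i}) a A" by auto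
  have card: "card I = Suc (card (I - {i}))"
    using i(1) \<open>finite I\<close> by (metis card.remove)
  show ?case
  proof (cases "k = 1")
    case True
    with card show ?thesis by simp
  next
    case False
    then have "m - 1 < k" "1 \<le> m - 1" "m - 1 + 1 = m"
      using less.prems(2) by (auto simp: m_def)
    then have "m - 1 < 2 * card (I - {i})"
      using less.IH[of "m - 1" "I - {i}"] i(2) \<open>finite I\<close> by simp
    with card show ?thesis by (auto simp: m_def split: if_splits)
  qed
qed

lemma fib_even_index_eq_sum: "fib (2 * m) = (\<Sum>i<m. fib (2 * i + 1))"
  by (induction m) auto

lemma emptied_in_fib:
  assumes "k + 1 \<le> 2 * n"
  shows "emptied_in (fib ` {2..k + 1}) n"
proof -
  define S where "S = fib ` {2..k + 1}"
  have "\<exists>J\<subseteq>{..<n}. s = (\<Sum>i\<in>J. fib (2 * i + 1))" if "s \<in> S" for s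
  proof -
    from that obtain j where j: "s = fib j" "j \<le> 2 * n"
      using assms unfolding S_def by auto
    show ?thesis
    proof (cases "even j")
      case True
      then obtain m where "j = 2 * m" by blast
      with j show ?thesis by (intro exI[of _ "{..<m}"]) (auto simp: fib_even_index_eq_sum)
    next
      case False
      then obtain m where "j = 2 * m + 1" by (elim oddE)
      with j show ?thesis by (intro exI[of _ "{m}"]) auto
    qed
  qed
  then obtain J where J: "\<And>s. s \<in> S \<Longrightarrow> J s \<subseteq> {..<n}"
      "\<And>s. s \<in> S \<Longrightarrow> s = (\<Sum>i\<in>J s. fib (2 * i + 1))"
    by metis
  have "splits S {..<n} (\<lambda>i. fib (2 * i + 1)) (\<lambda>i. {s\<in>S. i \<in> J s})"
    unfolding splits_def
  proof
    fix s assume s: "s \<in> S"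
    have "(\<Sum>i<n. if s \<in> {s\<in>S. i \<in> J s} then fib (2 * i + 1) else 0)
        = (\<Sum>i<n. if i \<in> J s then fib (2 * i + 1) else 0)"
      using s by simp
    also have "\<dots> = (\<Sum>i\<in>{..<n} \<inter> J s. fib (2 * i + 1))"
      by (rule sum.inter_restrict[symmetric]) simp
    also have "{..<n} \<inter> J s = J s" using J(1)[OF s] by blast
    finally show "s = (\<Sum>i<n. if s \<in> {s\<in>S. i \<in> J s} then fib (2 * i + 1) else 0)"
      using J(2)[OF s] by simp
  qed
  then show ?thesis
    unfolding S_def by (rule splits_imp_emptied_in) (auto intro: fib_neq_0_nat)
qed

theorem theorem4:
  fixes k :: nat
  assumes "k \<ge> 1"
  shows "int (CM (fib ` {2..k + 1})) = \<lceil>(real k + 1) / 2\<rceil>"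
proof -
  have "CM (fib ` {2..k + 1}) = (k + 2) div 2"
    unfolding CM_def
  proof (rule Least_equality)
    show "emptied_in (fib ` {2..k + 1}) ((k + 2) div 2)"
      by (rule emptied_in_fib) linarith
  next
    fix n assume "emptied_in (fib ` {2..k + 1}) n"
    then obtain a A where "splits (fib ` {2..k + 1}) {..<n} a A"
      using emptied_in_imp_splits by blast
    with splits_fib_lower_bound[of "{..<n}"] assms have "k < 2 * n" by simp
    then show "(k + 2) div 2 \<le> n" by linarith
  qed
  moreover have "\<lceil>(real k + 1) / 2\<rceil> = int ((k + 2) div 2)"
  proof (rule ceiling_unique)
    have "2 * ((k + 2) div 2) < k + 3" "k + 1 \<le> 2 * ((k + 2) div 2)" by linarith+
    then have "real (2 * ((k + 2) div 2)) < real (k + 3)"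
      and "real (k + 1) \<le> real (2 * ((k + 2) div 2))"
      unfolding of_nat_less_iff of_nat_le_iff .
    then show "real_of_int (int ((k + 2) div 2)) - 1 < (real k + 1) / 2"
      and "(real k + 1) / 2 \<le> real_of_int (int ((k + 2) div 2))"
      by (simp_all add: field_simps del: div_add_self2)
  qed
  ultimately show ?thesis by simp
qed

end
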